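(* Let $D\equiv 2,3\pmod 4$ be a squarefree positive integer with periodic continued fraction $\sqrt D=[u_0,\overline{u_1,u_2,\dots,u_{s-1},2u_0}]$, let $p_i/q_i=[u_0,\dots,u_i]$ be its $i$-th convergent, and let $N_i=|p_i^2-Dq_i^2|$. The following hold for every index $i\ge 0$ for which all the partial quotients $u_j$ occurring in the respective part exist (that is, have index $j\ge 0$). a) (Degree 1) For some $0<\varepsilon\le 1$ we have $$\frac{N_i}{2\sqrt D}=\frac 1{u_{i+1}}-\frac 1{u_{i+1}^2}\left(\frac 1{u_i}+\frac 1{u_{i+2}}\right)\varepsilon.$$ b) (Degree 3) Assume that $u_{i-1},u_i,u_{i+1},u_{i+2},u_{i+3}\ge u$ for some positive integer $u$. Then there is some $-1\le\varepsilon\le 1$ such that $$\frac{N_i}{2\sqrt D}=\frac 1{u_{i+1}}\left(1-\frac 1{u_iu_{i+1}}-\frac 1{u_{i+1}u_{i+2}}\right)+\frac{10}{u^5}\cdot\varepsilon.$$ c) (Degree 5) We have $$\frac{N_i}{2\sqrt D}=\frac{1}{u_{i+1}}\left[1-\frac 1{u_iu_{i+1}}-\frac 1{u_{i+1}u_{i+2}}+\left(\frac 1{u_iu_{i+1}}+\frac 1{u_{i+1}u_{i+2}}\right)^2+\frac 1{u_{i-1}u_i^2u_{i+1}}+\frac 1{u_{i+1}u_{i+2}^2u_{i+3}}\right]+\cdots,$$ where $\cdots$ stands for terms of total degree greater than $5$ in the $u_j^{-1}$. If $u$ is a positive integer such that $u_j\ge u$ for all $j$, then the error satisfies $|\cd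ots|<\frac{65}{u^7}$.
   Context: The partial quotients $u_j$ ($j\ge 0$) are positive integers with $u_{sk}=2u_0$ for $k>0$ and $u_{sk+j}=u_j$ for $k>0$, $1\le j\le s-1$. The convergents are given by $p_{-1}=1$, $p_0=u_0$, $q_{-1}=0$, $q_0=1$, $p_{i+1}=u_{i+1}p_i+p_{i-1}$, $q_{i+1}=u_{i+1}q_i+q_{i-1}$. With $\alpha_i=p_i+q_i\sqrt D$ and $N(x+y\sqrt D)=x^2-Dy^2$, one has $N_i=|N(\alpha_i)|$. Put $c_i=[u_i,u_{i+1},u_{i+2},\dots]$. The expansion of $N_i$ as $2\sqrt D$ times a power series in the $u_j^{-1}$ is obtained by recursively using the relations $N_i=\frac{2\sqrt D}{c_{i+1}}-\frac{N_{i-1}}{c_{i+1}^2}$ and $\frac 1{c_i}=\sum_{j\ge 0}\frac{(-1)^j}{u_i^{j+1}c_{i+1}^j}$; "total degree" means the total degree in the $u_j^{-1}$, with the factor $2\sqrt D$ not counted.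
   Formalization: Part c) is stated only for i ≥ 2: at i = 1 the term 1/(u_0 u_1^2 u_2) should carry a factor 1/2, and the printed claim fails, e.g. for D = 2210, √D = [47, 94, 94, …], u = 47, where the error times u^7 is about 69.2 > 65. *)

theory Defs
  imports
    Complex_Main
    "HOL-Library.Poly_Mapping"
    "HOL-Computational_Algebra.Formal_Power_Series"
    "HOL-Computational_Algebra.Squarefree"
begin

section \<open>Continued fractions of square roots\<close>

text \<open>Convergents \<open>p\<^sub>i / q\<^sub>i\<close>; the second equations are the recursion with
  \<open>p\<^sub>-\<^sub>1 = 1\<close> and \<open>q\<^sub>-\<^sub>1 = 0\<close> inserted.\<close>

fun conv_num :: "(nat \<Rightarrow> nat) \<Rightarrow> nat \<Rightarrow> nat" where
  "conv_num u 0 = u 0"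
| "conv_num u (Suc 0) = u 1 * u 0 + 1"
| "conv_num u (Suc (Suc i)) = u (Suc (Suc i)) * conv_num u (Suc i) + conv_num u i"

fun conv_den :: "(nat \<Rightarrow> nat) \<Rightarrow> nat \<Rightarrow> nat" where
  "conv_den u 0 = 1"
| "conv_den u (Suc 0) = u 1"
| "conv_den u (Suc (Suc i)) = u (Suc (Suc i)) * conv_den u (Suc i) + conv_den u i"

definition is_cf_of :: "(nat \<Rightarrow> nat) \<Rightarrow> real \<Rightarrow> bool" where
  "is_cf_of u x \<longleftrightarrow> (\<forall>j. u j > 0) \<and>
     (\<lambda>i. real (conv_num u i) / real (conv_den u i)) \<longlonglongrightarrow> x"

text \<open>\<open>u = [u\<^sub>0, u\<^sub>1, \<dots>, u\<^sub>s\<^sub>-\<^sub>1, 2u\<^sub>0, u\<^sub>1, \<dots>]\<close>, with the block after \<open>u\<^sub>0\<close> repeating.\<close>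

definition sqrt_period :: "(nat \<Rightarrow> nat) \<Rightarrow> nat \<Rightarrow> bool" where
  "sqrt_period u s \<longleftrightarrow> s \<ge> 1 \<and>
     (\<forall>k>0. u (s * k) = 2 * u 0) \<and>
     (\<forall>k>0. \<forall>j\<in>{1..s - 1}. u (s * k + j) = u j)"

definition conv_norm :: "nat \<Rightarrow> (nat \<Rightarrow> nat) \<Rightarrow> nat \<Rightarrow> int" where
  "conv_norm D u i = \<bar>(int (conv_num u i))\<^sup>2 - int D * (int (conv_den u i))\<^sup>2\<bar>"


section \<open>Formal expansion in the inverses of the partial quotients\<close>

text \<open>Power series in infinitely many indeterminates \<open>x\<^sub>0, x\<^sub>1, \<dots>\<close> standing for
  \<open>1/u\<^sub>0, 1/u\<^sub>1, \<dots>\<close>, graded by total degree: the coefficients are polynomials in the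
  \<open>x\<^sub>j\<close>, and each \<open>1/u\<^sub>j\<close> is represented by \<open>x\<^sub>j t\<close>, where \<open>t\<close> is the series variable
  \<^const>\<open>fps_X\<close>. Hence the coefficient of \<open>t\<^sup>n\<close> is exactly the homogeneous part of total
  degree \<open>n\<close> in the \<open>1/u\<^sub>j\<close>. Different indices give independent indeterminates.\<close>

type_synonym uinv_series = "((nat \<Rightarrow>\<^sub>0 nat) \<Rightarrow>\<^sub>0 rat) fps"

definition uinv :: "nat \<Rightarrow> uinv_series" where
  "uinv j = fps_const (Poly_Mapping.single (Poly_Mapping.single j 1) 1) * fps_X"

text \<open>The series of \<open>1/c\<^sub>j\<close>, where \<open>c\<^sub>j = [u\<^sub>j, u\<^sub>j\<^sub>+\<^sub>1, \<dots>]\<close>. It is determined by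
  \<open>1/c\<^sub>j = \<Sum>k\<ge>0. (-1)\<^sup>k / (u\<^sub>j\<^sup>k\<^sup>+\<^sup>1 c\<^sub>j\<^sub>+\<^sub>1\<^sup>k)\<close>, proved as \<open>cinv_sums\<close> below;
  applying this relation \<open>n\<close> times gives the terms of degree at most \<open>n\<close>.\<close>

fun cinv_approx :: "nat \<Rightarrow> nat \<Rightarrow> uinv_series" where
  "cinv_approx 0 j = 0"
| "cinv_approx (Suc n) j = (\<Sum>k\<le>n. (-1) ^ k * uinv j ^ (k + 1) * cinv_approx n (j + 1) ^ k)"

definition cinv :: "nat \<Rightarrow> uinv_series" where
  "cinv j = Abs_fps (\<lambda>n. fps_nth (cinv_approx n j) n)"

text \<open>The series of \<open>N\<^sub>i / (2 \<surd>D)\<close>, from \<open>N\<^sub>i = 2 \<surd>D / c\<^sub>i\<^sub>+\<^sub>1 - N\<^sub>i\<^sub>-\<^sub>1 / c\<^sub>i\<^sub>+\<^sub>1\<^sup>2\<close> for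
  \<open>i \<ge> 0\<close>. The recursion ends at \<open>N\<^sub>-\<^sub>1 = 1\<close>; since \<open>c\<^sub>0 = \<surd>D\<close>,
  \<open>N\<^sub>-\<^sub>1 / (2 \<surd>D) = 1 / (2 c\<^sub>0)\<close>.\<close>

definition half :: uinv_series where
  "half = fps_const (Poly_Mapping.single 0 (1/2))"

fun norm_expansion :: "nat \<Rightarrow> uinv_series" where
  "norm_expansion 0 = cinv 1 - half * cinv 0 * cinv 1 ^ 2"
| "norm_expansion (Suc i) = cinv (i + 2) - norm_expansion i * cinv (i + 2) ^ 2"


subsection \<open>The defining relation of \<open>cinv\<close>\<close>

definition agree :: "nat \<Rightarrow> uinv_series \<Rightarrow> uinv_series \<Rightarrow> bool" where
  "agree n f g \<longleftrightarrow> (\<forall>d\<le>n. fps_nth f d = fps_nth g d)"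

lemma agree_mult: "agree n f g \<Longrightarrow> agree n f' g' \<Longrightarrow> agree n (f * f') (g * g')"
  unfolding agree_def fps_mult_nth by (auto intro!: sum.cong)

lemma agree_power: "agree n f g \<Longrightarrow> agree n (f ^ k) (g ^ k)"
  by (induction k) (auto simp: agree_mult, simp add: agree_def)

lemma agree_sum: "(\<And>k. k \<in> A \<Longrightarrow> agree n (f k) (g k)) \<Longrightarrow> agree n (sum f A) (sum g A)"
  unfolding agree_def by (auto simp: fps_sum_nth intro!: sum.cong)

lemma uinv_nth_0: "fps_nth (uinv j) 0 = 0"
  by (simp add: uinv_def)

lemma uinv_mult_nth_Suc:
  "fps_nth (uinv j * f) (Suc d) = Poly_Mapping.single (Poly_Mapping.single j 1) 1 * fps_nth f d"
  by (simp add: uinv_def mult.assoc)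

lemma agree_uinv_mult: "agree n f g \<Longrightarrow> agree (Suc n) (uinv j * f) (uinv j * g)"
  unfolding agree_def
proof (intro allI impI)
  fix d assume "\<forall>d\<le>n. fps_nth f d = fps_nth g d" and "d \<le> Suc n"
  then show "fps_nth (uinv j * f) d = fps_nth (uinv j * g) d"
    by (cases d) (simp_all only: uinv_mult_nth_Suc, simp_all add: uinv_nth_0)
qed

lemma agree_uinv_power: "agree n (uinv j ^ Suc n * f) 0"
proof (induction n)
  case 0 then show ?case by (simp add: agree_def uinv_nth_0)
next
  case (Suc n)
  from agree_uinv_mult[OF this, of j] show ?case by (simp add: mult.assoc)
qed

lemma agree_summand:
  assumes "agree n f g"
  shows "agree (Suc n) ((-1) ^ k * uinv j ^ (k + 1) * f ^ k) ((-1) ^ k * uinv j ^ (k + 1) * g ^ k)"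
proof -
  have "agree n ((-1) ^ k * uinv j ^ k * f ^ k) ((-1) ^ k * uinv j ^ k * g ^ k)"
    by (intro agree_mult agree_power assms) (simp_all add: agree_def)
  from agree_uinv_mult[OF this, of j] show ?thesis by (simp add: ac_simps)
qed

lemma agree_summand_0:
  assumes "n \<le> k"
  shows "agree n ((-1) ^ k * uinv j ^ (k + 1) * f ^ k) 0"
proof -
  obtain l where k: "k = n + l" using assms le_Suc_ex by blast
  have "(-1) ^ k * uinv j ^ (k + 1) * f ^ k = uinv j ^ Suc n * (uinv j ^ l * (-1) ^ k * f ^ k)"
    by (simp add: k power_add ac_simps)
  then show ?thesis using agree_uinv_power by metis
qed

lemma agree_partial:
  assumes "agree n f g" "Suc n \<le> a" "a \<le> b"
  shows "agree (Suc n) (\<Sum>k<a. (-1) ^ k * uinv j ^ (k + 1) * f ^ k)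
                       (\<Sum>k<b. (-1) ^ k * uinv j ^ (k + 1) * g ^ k)"
proof -
  let ?h = "\<lambda>f k. (-1) ^ k * uinv j ^ (k + 1) * f ^ k"
  have 1: "agree (Suc n) (\<Sum>k<a. ?h f k) (\<Sum>k<a. ?h g k)"
    by (intro agree_sum agree_summand assms)
  have 2: "agree (Suc n) (\<Sum>k\<in>{a..<b}. ?h g k) (\<Sum>k\<in>{a..<b}. 0)"
    using assms(2) by (intro agree_sum agree_summand_0) auto
  have "(\<Sum>k<b. ?h g k) = (\<Sum>k<a. ?h g k) + (\<Sum>k\<in>{a..<b}. ?h g k)"
    using sum.atLeastLessThan_concat[OF le0 assms(3), of "?h g"] by (simp only: lessThan_atLeast0)
  moreover have "agree (Suc n) ((\<Sum>k<a. ?h f k) + 0) ((\<Sum>k<a. ?h g k) + (\<Sum>k\<in>{a..<b}. ?h g k))"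
    using 1 2 by (simp only: agree_def sum.neutral_const fps_add_nth fps_zero_nth) simp
  ultimately show ?thesis by (simp only: add_0_right)
qed

lemma agree_cinv_approx_Suc: "agree n (cinv_approx n j) (cinv_approx (Suc n) j)"
proof (induction n arbitrary: j)
  case 0 then show ?case by (simp add: agree_def uinv_nth_0)
next
  case (Suc n)
  show ?case
    using agree_partial[OF Suc.IH[of "j + 1"], of "Suc n" "Suc (Suc n)" j]
    by (simp only: cinv_approx.simps lessThan_Suc_atMost le_refl le_Suc_eq simp_thms)
qed

lemma agree_cinv: "agree n (cinv_approx n j) (cinv j)"
proof -
  have "fps_nth (cinv_approx m j) d = fps_nth (cinv_approx d j) d" if "d \<le> m" for d m
    using that
  proof (induction rule: dec_induct)
    case (step m)
    from agree_cinv_approx_Suc[of m j] step show ?case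
      by (simp only: agree_def less_imp_le)
  qed (rule refl)
  then show ?thesis unfolding agree_def cinv_def fps_nth_Abs_fps by blast
qed

lemma cinv_sums: "(\<lambda>k. (-1) ^ k * uinv j ^ (k + 1) * cinv (j + 1) ^ k) sums cinv j"
  unfolding sums_def
proof (rule tendsto_fpsI)
  fix d
  let ?S = "\<lambda>m. \<Sum>k<m. (-1) ^ k * uinv j ^ (k + 1) * cinv (j + 1) ^ k"
  have "fps_nth (?S m) d = fps_nth (cinv j) d" if m: "Suc d \<le> m" for m
  proof -
    have "agree (Suc d) (cinv_approx (Suc d) j) (?S m)"
      unfolding cinv_approx.simps lessThan_Suc_atMost[symmetric]
      by (rule agree_partial[OF agree_cinv le_refl m])
    then have "fps_nth (cinv_approx (Suc d) j) d = fps_nth (?S m) d"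
      unfolding agree_def by (elim allE[of _ d] impE) (rule le_SucI[OF le_refl])
    moreover have "fps_nth (cinv_approx (Suc d) j) d = fps_nth (cinv j) d"
      using agree_cinv[of "Suc d" j] unfolding agree_def
      by (elim allE[of _ d] impE) (rule le_SucI[OF le_refl])
    ultimately show ?thesis by (rule trans[OF sym])
  qed
  then show "\<forall>\<^sub>F m in sequentially. fps_nth (?S m) d = fps_nth (cinv j) d"
    by (rule eventually_sequentiallyI)
qed

end

theory Submission
  imports Defs
begin

text \<open>Write \<open>c\<^sub>i = [u\<^sub>i, u\<^sub>i\<^sub>+\<^sub>1, \<dots>]\<close> for the complete quotients of
  \<open>\<surd>D\<close> and \<open>d\<^sub>i = [u\<^sub>i, u\<^sub>i\<^sub>-\<^sub>1, \<dots>, u\<^sub>1, u\<^sub>0 + \<surd>D]\<close> for the mirrored ones, so that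
  \<open>-1/d\<^sub>i\<close> is the conjugate of \<open>c\<^sub>i\<^sub>+\<^sub>1\<close> over the rationals. Since \<open>c\<^sub>i\<^sub>+\<^sub>1\<close> has the form
  \<open>(P + \<surd>D) / N\<^sub>i\<close> with an integer \<open>P\<close>, subtracting its conjugate gives the exact formula
  \<open>2\<surd>D / N\<^sub>i = c\<^sub>i\<^sub>+\<^sub>1 + 1/d\<^sub>i = u\<^sub>i\<^sub>+\<^sub>1 + 1/c\<^sub>i\<^sub>+\<^sub>2 + 1/d\<^sub>i\<close> (lemmas \<open>conv_norm_quotients\<close> and
  \<open>conv_norm_reciprocal\<close>; there it is proved by induction from the recursions of the convergents).

  All the numerical estimates follow from this symmetric formula. With \<open>U = u\<^sub>i\<^sub>+\<^sub>1\<close> and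
  \<open>y = 1/c\<^sub>i\<^sub>+\<^sub>2 + 1/d\<^sub>i\<close> one expands \<open>1 / (U + y)\<close> as a geometric series with remainder, and then
  replaces \<open>1/c\<^sub>i\<^sub>+\<^sub>2\<close> and \<open>1/d\<^sub>i\<close> by the first terms of their own expansions. If all partial
  quotients involved are at least \<open>v\<close>, the errors add up to \<open>6/v\<^sup>5\<close> for the approximation of degree 3
  and to \<open>20/v\<^sup>7\<close> for the one of degree 5 (\<open>recip_error_degree_3\<close>, \<open>recip_error_degree_5\<close>).

  For the formal series, summing the geometric series that defines \<open>cinv\<close> gives the fixed point
  equation \<open>cinv_rec\<close>. A product of two series without constant term is known to one degree more
  than its factors, and multiplication by \<open>1/u\<^sub>j\<close> gains another degree; hence each use of
  \<open>cinv_rec\<close>, and likewise of the recursion of \<open>norm_expansion\<close>, extends a known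
  truncation by two degrees. Three rounds, starting from the vanishing constant terms, give the
  expansion up to degree 6, which is \<open>norm_expansion_degree_6\<close>.\<close>

section \<open>The norm in terms of complete quotients\<close>

lemma conv_den_pos: "(\<And>j. u j > 0) \<Longrightarrow> conv_den u i > 0"
  by (induction u i rule: conv_den.induct) auto

lemma conv_determinant:
  "int (conv_num u (Suc i)) * int (conv_den u i) - int (conv_num u i) * int (conv_den u (Suc i))
    = (-1) ^ i"
proof (induction i)
  case 0
  then show ?case by (simp add: algebra_simps)
next
  case (Suc i)
  then show ?case by (simp add: algebra_simps)
qed

text \<open>The determinant formula gives the difference of two convergents whose indices differ by 2; its
  sign makes the even convergents increase and the odd ones decrease.\<close>

lemma conv_step_two:
  "real (conv_num u (Suc (Suc i))) * real (conv_den u i)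
     - real (conv_num u i) * real (conv_den u (Suc (Suc i)))
    = (-1) ^ i * real (u (Suc (Suc i)))"
proof -
  have "real_of_int (int (conv_num u (Suc i)) * int (conv_den u i)
      - int (conv_num u i) * int (conv_den u (Suc i))) = (-1) ^ i"
    by (simp only: conv_determinant) simp
  then have "real (conv_num u (Suc i)) * real (conv_den u i)
      - real (conv_num u i) * real (conv_den u (Suc i)) = (-1) ^ i"
    by simp
  then have "((-1) ^ i * real (u (Suc (Suc i)))) = (real (conv_num u (Suc i)) * real (conv_den u i)
      - real (conv_num u i) * real (conv_den u (Suc i))) * real (u (Suc (Suc i)))"
    by simp
  then show ?thesis by (simp add: algebra_simps)
qed

text \<open>The sign makes the residual of the continued fraction of \<open>x\<close> equal to
  \<open>\<bar>x q\<^sub>i - p\<^sub>i\<bar>\<close>, see \<open>residual_pos\<close>.\<close>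

definition residual :: "(nat \<Rightarrow> nat) \<Rightarrow> real \<Rightarrow> nat \<Rightarrow> real" where
  "residual u x i = (-1) ^ i * (x * real (conv_den u i) - real (conv_num u i))"

lemma residual_simps:
  "residual u x 0 = x - real (u 0)"
  "residual u x (Suc 0) = 1 - real (u 1) * residual u x 0"
  "residual u x (Suc (Suc i)) = residual u x i - real (u (Suc (Suc i))) * residual u x (Suc i)"
  by (simp_all add: residual_def algebra_simps)

text \<open>Convergents of the same parity as \<open>i\<close> approach \<open>x\<close> strictly monotonically, so the \<open>i\<close>-th
  one lies strictly on the side of \<open>x\<close> that is determined by the parity of \<open>i\<close>.\<close>

lemma residual_pos:
  assumes "is_cf_of u x"
  shows "residual u x i > 0"
proof -
  have upos: "\<And>j. u j > 0"
    and lim: "(\<lambda>i. real (conv_num u i) / real (conv_den u i)) \<longlonglongrightarrow> x"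
    using assms by (auto simp: is_cf_of_def)
  note qpos = conv_den_pos[of u, OF upos]
  define r where "r = (\<lambda>i. real (conv_num u i) / real (conv_den u i))"
  define t where "t k = (-1) ^ i * r (i + 2 * k)" for k
  have step: "t k < t (Suc k)" for k
  proof -
    let ?m = "i + 2 * k"
    have "r (Suc (Suc ?m)) - r ?m
        = (-1) ^ ?m * real (u (Suc (Suc ?m))) / (real (conv_den u ?m) * real (conv_den u (Suc (Suc ?m))))"
      unfolding r_def conv_step_two[symmetric]
      using qpos[of ?m] qpos[of "Suc (Suc ?m)"]
      by (simp add: diff_frac_eq del: conv_den.simps conv_num.simps)
    then have "t (Suc k) - t k
        = real (u (Suc (Suc ?m))) / (real (conv_den u ?m) * real (conv_den u (Suc (Suc ?m))))"
      unfolding t_def by (simp add: right_diff_distrib[symmetric] power_add del: conv_den.simps conv_num.simps)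
    also have "\<dots> > 0"
      using qpos[of ?m] qpos[of "Suc (Suc ?m)"] upos[of "Suc (Suc ?m)"]
      by (simp del: conv_den.simps)
    finally show ?thesis by simp
  qed
  have "strict_mono (\<lambda>k. i + 2 * k)" by (simp add: strict_mono_def)
  then have "(\<lambda>k. r (i + 2 * k)) \<longlonglongrightarrow> x"
    using LIMSEQ_subseq_LIMSEQ[OF lim] unfolding r_def comp_def by blast
  then have "t \<longlonglongrightarrow> (-1) ^ i * x"
    unfolding t_def by (intro tendsto_intros)
  moreover have "incseq t" using step by (intro incseq_SucI less_imp_le)
  ultimately have "t 1 \<le> (-1) ^ i * x" by (rule incseq_le[rotated])
  with step[of 0] have "(-1) ^ i * r i < (-1) ^ i * x" by (simp add: t_def)
  then have "0 < (-1) ^ i * (x - r i)" by (simp add: algebra_simps)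
  then have "0 < (-1) ^ i * (x - r i) * real (conv_den u i)"
    using qpos[of i] by simp
  also have "\<dots> = residual u x i"
    using qpos[of i] by (simp add: residual_def r_def field_simps)
  finally show ?thesis .
qed

primrec complete_quot :: "(nat \<Rightarrow> nat) \<Rightarrow> real \<Rightarrow> nat \<Rightarrow> real" where
  "complete_quot u x 0 = x"
| "complete_quot u x (Suc i) = 1 / (complete_quot u x i - real (u i))"

text \<open>Both sides satisfy the same recursion, because the residuals inherit the three-term recursion of
  the convergents. In this way the positivity of the residuals passes to the complete quotients,
  so that the divisions in their definition are never by zero.\<close>

lemma complete_quot_residual:
  assumes "is_cf_of u x"
  shows "complete_quot u x (Suc (Suc i)) = residual u x i / residual u x (Suc i)"
proof (induction i)
  case 0
  show ?case using residual_pos[OF assms, of 0] residual_pos[OF assms, of 1]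
    by (simp add: residual_simps field_simps)
next
  case (Suc i)
  have "complete_quot u x (Suc (Suc (Suc i)))
      = 1 / (residual u x i / residual u x (Suc i) - real (u (Suc (Suc i))))"
    by (simp only: complete_quot.simps(2)[of u x "Suc (Suc i)"] Suc)
  also have "\<dots> = residual u x (Suc i) / residual u x (Suc (Suc i))"
    using residual_pos[OF assms, of "Suc i"] by (simp add: residual_simps(3) field_simps)
  finally show ?case .
qed

lemma complete_quot_pos:
  assumes "is_cf_of u x"
  shows "complete_quot u x (Suc i) > 0"
proof (cases i)
  case 0
  then show ?thesis using residual_pos[OF assms, of 0] by (simp add: residual_simps)
next
  case (Suc k)
  then show ?thesis using residual_pos[OF assms]
    by (simp add: complete_quot_residual[OF assms] del: complete_quot.simps)
qed

lemma complete_quot_unfold: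
  assumes "is_cf_of u x"
  shows "complete_quot u x i = real (u i) + 1 / complete_quot u x (Suc i)"
  using complete_quot_pos[OF assms, of i] by simp

lemma complete_quot_gt:
  assumes "is_cf_of u x"
  shows "complete_quot u x i > real (u i)"
  using complete_quot_unfold[OF assms, of i] complete_quot_pos[OF assms, of i] by simp

text \<open>The mirrored quotients \<open>[u\<^sub>i, u\<^sub>i\<^sub>-\<^sub>1, \<dots>, u\<^sub>1, u\<^sub>0 + x]\<close>. For \<open>x = \<surd>D\<close> the value with
  index \<open>i\<close> is \<open>-1\<close> divided by the conjugate of the complete quotient with index \<open>i + 1\<close>.\<close>

primrec mirror_quot :: "(nat \<Rightarrow> nat) \<Rightarrow> real \<Rightarrow> nat \<Rightarrow> real" where
  "mirror_quot u x 0 = real (u 0) + x"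
| "mirror_quot u x (Suc i) = real (u (Suc i)) + 1 / mirror_quot u x i"

lemma mirror_quot_gt:
  assumes "x > 0" "u 0 > 0"
  shows "mirror_quot u x i > real (u i)"
proof (induction i)
  case 0
  then show ?case using assms by simp
next
  case (Suc i)
  then have "mirror_quot u x i > 0" by (meson le_less_trans of_nat_0_le_iff)
  then show ?case by simp
qed

text \<open>The counterpart of \<open>complete_quot_residual\<close> for the conjugate numbers \<open>p\<^sub>i + q\<^sub>i x\<close>: these
  obey the recursion of the convergents themselves, and start with \<open>u\<^sub>0 + x\<close>.\<close>

lemma conv_sum_mirror_quot:
  assumes "x > 0" "u 0 > 0"
  shows "real (conv_num u (Suc i)) + real (conv_den u (Suc i)) * x
    = mirror_quot u x (Suc i) * (real (conv_num u i) + real (conv_den u i) * x)"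
proof (induction i)
  case 0
  have "real (u 0) + x > 0" using assms by simp
  then show ?case by (simp add: field_simps)
next
  case (Suc i)
  have "mirror_quot u x (Suc i) > 0"
    using mirror_quot_gt[of x u "Suc i", OF assms] by (meson le_less_trans of_nat_0_le_iff)
  moreover have "real (conv_num u (Suc (Suc i))) + real (conv_den u (Suc (Suc i))) * x
    = real (u (Suc (Suc i))) * (real (conv_num u (Suc i)) + real (conv_den u (Suc i)) * x)
      + (real (conv_num u i) + real (conv_den u i) * x)"
    by (simp add: algebra_simps)
  ultimately show ?case
    unfolding Suc mirror_quot.simps(2)[of u x "Suc i"]
    by (simp add: field_simps del: mirror_quot.simps)
qed

lemma conv_norm_eq:
  assumes "D > 0" "is_cf_of u (sqrt (real D))"
  shows "real_of_int (conv_norm D u i) = residual u (sqrt (real D)) i *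
    (real (conv_num u i) + real (conv_den u i) * sqrt (real D))"
proof -
  let ?x = "sqrt (real D)" and ?p = "real (conv_num u i)" and ?q = "real (conv_den u i)"
  have "real_of_int (conv_norm D u i) = \<bar>?p\<^sup>2 - ?x\<^sup>2 * ?q\<^sup>2\<bar>"
    by (simp add: conv_norm_def)
  also have "?p\<^sup>2 - ?x\<^sup>2 * ?q\<^sup>2 = - ((?x * ?q - ?p) * (?p + ?q * ?x))"
    by (simp add: power2_eq_square algebra_simps)
  also have "\<bar>\<dots>\<bar> = \<bar>residual u ?x i\<bar> * (?p + ?q * ?x)"
    by (simp add: residual_def abs_mult)
  also have "\<bar>residual u ?x i\<bar> = residual u ?x i"
    using residual_pos[OF assms(2), of i] by simp
  finally show ?thesis .
qed

text \<open>Passing from \<open>i\<close> to \<open>i + 1\<close> multiplies the norm by \<open>d\<^sub>i\<^sub>+\<^sub>1 / c\<^sub>i\<^sub>+\<^sub>2\<close>, by the two ratio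
  lemmas for its factors. Hence
  \<open>N\<^sub>i\<^sub>+\<^sub>1 (c\<^sub>i\<^sub>+\<^sub>2 + 1/d\<^sub>i\<^sub>+\<^sub>1) = N\<^sub>i (d\<^sub>i\<^sub>+\<^sub>1 + 1/c\<^sub>i\<^sub>+\<^sub>2)\<close>, and moving the partial quotient \<open>u\<^sub>i\<^sub>+\<^sub>1\<close>
  from \<open>d\<^sub>i\<^sub>+\<^sub>1\<close> to \<open>c\<^sub>i\<^sub>+\<^sub>1\<close> turns the right-hand side into \<open>N\<^sub>i (c\<^sub>i\<^sub>+\<^sub>1 + 1/d\<^sub>i)\<close>. So the product
  does not depend on \<open>i\<close>.\<close>

lemma conv_norm_quotients:
  assumes "D > 0" "is_cf_of u (sqrt (real D))"
  shows "real_of_int (conv_norm D u i) *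
    (complete_quot u (sqrt (real D)) (Suc i) + 1 / mirror_quot u (sqrt (real D)) i)
    = 2 * sqrt (real D)"
proof -
  let ?x = "sqrt (real D)"
  let ?N = "\<lambda>i. real_of_int (conv_norm D u i)"
  let ?c = "complete_quot u ?x" and ?d = "mirror_quot u ?x"
  have xpos: "?x > 0" and u0: "u 0 > 0" using assms by (auto simp: is_cf_of_def)
  show ?thesis
  proof (induction i)
    case 0
    have *: "e * f * (1 / e + 1 / f) = f + e" if "e > 0" "f > 0" for e f :: real
      using that by (simp add: field_simps)
    have "?x - real (u 0) > 0" using residual_pos[OF assms(2), of 0] by (simp add: residual_simps)
    moreover have "real (u 0) + ?x > 0" using xpos by (simp add: add_nonneg_pos)
    ultimately have "(?x - real (u 0)) * (real (u 0) + ?x)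
        * (1 / (?x - real (u 0)) + 1 / (real (u 0) + ?x)) = 2 * ?x"
      by (subst *) simp_all
    then show ?case
      unfolding conv_norm_eq[OF assms] by (simp add: residual_simps)
  next
    case (Suc i)
    have c: "?c (Suc (Suc i)) > 0" by (rule complete_quot_pos[OF assms(2)])
    have d: "?d (Suc i) > 0"
      using mirror_quot_gt[of ?x u "Suc i", OF xpos u0] by (meson le_less_trans of_nat_0_le_iff)
    have e: "residual u ?x (Suc i) = residual u ?x i / ?c (Suc (Suc i))"
      using residual_pos[OF assms(2), of i] unfolding complete_quot_residual[OF assms(2)] by simp
    have "?N (Suc i) = ?N i * ?d (Suc i) / ?c (Suc (Suc i))"
      unfolding conv_norm_eq[OF assms] e conv_sum_mirror_quot[of ?x u, OF xpos u0] by simp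
    then have "?N (Suc i) * (?c (Suc (Suc i)) + 1 / ?d (Suc i))
        = ?N i * (?d (Suc i) + 1 / ?c (Suc (Suc i)))"
      using c d by (simp add: field_simps del: complete_quot.simps mirror_quot.simps)
    also have "?d (Suc i) + 1 / ?c (Suc (Suc i)) = ?c (Suc i) + 1 / ?d i"
      unfolding complete_quot_unfold[OF assms(2), of "Suc i"]
      by (simp del: complete_quot.simps)
    finally show ?case using Suc by simp
  qed
qed

lemma conv_norm_reciprocal:
  assumes "D > 0" "is_cf_of u (sqrt (real D))"
  shows "real_of_int (conv_norm D u i) / (2 * sqrt (real D))
    = 1 / (real (u (i+1)) +
        (1 / mirror_quot u (sqrt (real D)) i + 1 / complete_quot u (sqrt (real D)) (i+2)))"
proof -
  let ?N = "real_of_int (conv_norm D u i)"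
  let ?S = "real (u (i+1)) + (1 / mirror_quot u (sqrt (real D)) i
              + 1 / complete_quot u (sqrt (real D)) (i+2))"
  have "?N * ?S = 2 * sqrt (real D)"
    using conv_norm_quotients[OF assms, of i] complete_quot_unfold[OF assms(2), of "Suc i"]
    by (simp add: ac_simps del: complete_quot.simps)
  moreover have "2 * sqrt (real D) \<noteq> 0" using assms(1) by simp
  ultimately show ?thesis
    by (metis mult_cancel_left1 mult_zero_right nonzero_divide_mult_cancel_left
        divide_divide_eq_right div_by_1 mult_zero_left)
qed

section \<open>Error estimates for reciprocals\<close>

lemma recip_diff:
  fixes a z :: real
  assumes "a \<noteq> 0" "a + z \<noteq> 0"
  shows "1 / a - 1 / (a + z) = z / (a * (a + z))"
  using assms by (simp add: field_simps)

lemma recip_shift_bounds: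
  fixes a z v :: real
  assumes "0 < v" "v \<le> a" "0 \<le> z" "z \<le> 1 / v"
  shows "0 \<le> 1 / a - 1 / (a + z)" "1 / a - 1 / (a + z) \<le> 1 / v ^ 3"
proof -
  have "1 / a - 1 / (a + z) = z / (a * (a + z))"
    using assms by (intro recip_diff) simp_all
  moreover have "z / (a * (a + z)) \<le> (1 / v) / (v * v)"
    using assms by (intro frac_le mult_mono) auto
  moreover have "0 \<le> z / (a * (a + z))" using assms by simp
  ultimately show "0 \<le> 1 / a - 1 / (a + z)" "1 / a - 1 / (a + z) \<le> 1 / v ^ 3"
    by (simp_all add: power3_eq_cube)
qed

lemma recip_expand_2:
  fixes a z :: real
  assumes "a \<noteq> 0" "a + z \<noteq> 0"
  shows "1 / (a + z) = 1 / a - z / a ^ 2 + z ^ 2 / (a ^ 2 * (a + z))"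
proof -
  have "1 / s = 1 / a - (s - a) / a ^ 2 + (s - a) ^ 2 / (a ^ 2 * s)" if "s \<noteq> 0" for s
    using assms(1) that by (simp add: field_simps power2_eq_square)
  from this[OF assms(2)] show ?thesis by simp
qed

lemma recip_expand_3:
  fixes a z :: real
  assumes "a \<noteq> 0" "a + z \<noteq> 0"
  shows "1 / (a + z) = 1 / a - z / a ^ 2 + z ^ 2 / a ^ 3 - z ^ 3 / (a ^ 3 * (a + z))"
proof -
  have "1 / s = 1 / a - (s - a) / a ^ 2 + (s - a) ^ 2 / a ^ 3 - (s - a) ^ 3 / (a ^ 3 * s)"
    if "s \<noteq> 0" for s
    using assms(1) that by (simp add: field_simps eval_nat_numeral)
  from this[OF assms(2)] show ?thesis by simp
qed

text \<open>The truncated term \<open>1/(a\<^sup>2 b)\<close> contributes two positive errors: replacing \<open>1/(b + w)\<close> by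
  \<open>1/b\<close> in the linear term, and dropping the quadratic term. Each is at most \<open>1/v\<^sup>5\<close>.\<close>

lemma recip_two_levels_bound:
  fixes a b w v :: real
  assumes "0 < v" "v \<le> a" "v \<le> b" "0 \<le> w" "w \<le> 1 / v"
  shows "\<bar>1 / (a + 1 / (b + w)) - (1 / a - 1 / (a ^ 2 * b))\<bar> \<le> 2 / v ^ 5"
proof -
  define z where "z = 1 / (b + w)"
  have z: "0 \<le> z" "z \<le> 1 / v"
    using assms by (auto simp: z_def intro!: divide_left_mono frac_le)
  have dz: "0 \<le> 1 / b - z" "1 / b - z \<le> 1 / v ^ 3"
    using recip_shift_bounds[of v b w] assms by (simp_all add: z_def)
  have "1 / (a + z) - (1 / a - 1 / (a ^ 2 * b)) = (1 / b - z) / a ^ 2 + z ^ 2 / (a ^ 2 * (a + z))"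
    using assms z by (subst recip_expand_2) (simp_all add: diff_divide_distrib mult.commute)
  moreover have "(1 / b - z) / a ^ 2 \<le> (1 / v ^ 3) / v ^ 2"
    using assms dz by (intro frac_le power_mono) auto
  moreover have "z ^ 2 / (a ^ 2 * (a + z)) \<le> (1 / v) ^ 2 / (v ^ 2 * v)"
    using assms z by (intro frac_le mult_mono power_mono) auto
  moreover have "0 \<le> (1 / b - z) / a ^ 2" "0 \<le> z ^ 2 / (a ^ 2 * (a + z))"
    using assms dz z by auto
  moreover have "(1 / v ^ 3) / v ^ 2 = 1 / v ^ 5" "(1 / v) ^ 2 / (v ^ 2 * v) = 1 / v ^ 5"
    using assms by (simp_all add: field_simps eval_nat_numeral)
  ultimately show ?thesis by (simp add: z_def)
qed

text \<open>Here \<open>y\<close> stands for \<open>1/c\<^sub>i\<^sub>+\<^sub>2 + 1/d\<^sub>i\<close> and \<open>y0\<close> for its leading term. Of the total 6,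
  4 comes from the remainder of the geometric series and 2 from exchanging \<open>y\<close> for \<open>y0\<close>.\<close>

lemma recip_error_degree_3:
  fixes U y y0 v :: real
  assumes "0 < v" "v \<le> U" "0 \<le> y" "y \<le> 2 / v" "\<bar>y - y0\<bar> \<le> 2 / v ^ 3"
  shows "\<bar>1 / (U + y) - (1 / U - y0 / U ^ 2)\<bar> \<le> 6 / v ^ 5"
proof -
  have "1 / (U + y) - (1 / U - y0 / U ^ 2) = y ^ 2 / (U ^ 2 * (U + y)) - (y - y0) / U ^ 2"
    using assms by (subst recip_expand_2) (simp_all add: diff_divide_distrib)
  also have "\<bar>\<dots>\<bar> \<le> \<bar>y ^ 2 / (U ^ 2 * (U + y))\<bar> + \<bar>(y - y0) / U ^ 2\<bar>"
    by (rule abs_triangle_ineq4)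
  also have "\<bar>y ^ 2 / (U ^ 2 * (U + y))\<bar> = y ^ 2 / (U ^ 2 * (U + y))" using assms by simp
  also have "\<dots> \<le> (2 / v) ^ 2 / (v ^ 2 * v)"
    using assms by (intro frac_le mult_mono power_mono) auto
  also have "\<bar>(y - y0) / U ^ 2\<bar> = \<bar>y - y0\<bar> / U ^ 2" by simp
  also have "\<dots> \<le> (2 / v ^ 3) / v ^ 2"
    using assms by (intro frac_le power_mono) auto
  also have "(2 / v) ^ 2 / (v ^ 2 * v) + (2 / v ^ 3) / v ^ 2 = 6 / v ^ 5"
    using assms by (simp add: field_simps eval_nat_numeral)
  finally show ?thesis by simp
qed

text \<open>The linear term needs the finer approximation \<open>y1\<close> of \<open>y\<close>, for the quadratic term the
  leading part \<open>y0\<close> suffices. The exchanges cost 4 and 8, the cubic remainder another 8.\<close>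

lemma recip_error_degree_5:
  fixes U y y0 y1 v :: real
  assumes "0 < v" "v \<le> U" "0 \<le> y" "y \<le> 2 / v" "0 \<le> y0" "y0 \<le> 2 / v"
    and "\<bar>y - y0\<bar> \<le> 2 / v ^ 3" "\<bar>y - y1\<bar> \<le> 4 / v ^ 5"
  shows "\<bar>1 / (U + y) - (1 / U - y1 / U ^ 2 + y0 ^ 2 / U ^ 3)\<bar> \<le> 20 / v ^ 7"
proof -
  let ?A = "(y - y1) / U ^ 2" and ?B = "(y - y0) * (y + y0) / U ^ 3" and ?C = "y ^ 3 / (U ^ 3 * (U + y))"
  have "1 / (U + y) = 1 / U - y / U ^ 2 + y ^ 2 / U ^ 3 - ?C"
    using assms by (intro recip_expand_3) simp_all
  moreover have "?A = y / U ^ 2 - y1 / U ^ 2" by (simp add: diff_divide_distrib)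
  moreover have "?B = y ^ 2 / U ^ 3 - y0 ^ 2 / U ^ 3"
    by (simp add: diff_divide_distrib[symmetric] power2_eq_square algebra_simps)
  ultimately have "1 / (U + y) - (1 / U - y1 / U ^ 2 + y0 ^ 2 / U ^ 3) = - ?A + ?B - ?C"
    by simp
  moreover have "\<bar>?A\<bar> \<le> (4 / v ^ 5) / v ^ 2"
    unfolding abs_divide using assms by (intro frac_le) (auto intro: power_mono)
  moreover have "\<bar>?B\<bar> \<le> (2 / v ^ 3 * (2 / v + 2 / v)) / v ^ 3"
    unfolding abs_divide abs_mult using assms by (intro frac_le mult_mono) (auto intro: power_mono)
  moreover have "\<bar>?C\<bar> \<le> (2 / v) ^ 3 / (v ^ 3 * v)"
    unfolding abs_divide abs_mult using assms
    by (intro frac_le mult_mono) (auto intro: power_mono)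
  moreover have "(4 / v ^ 5) / v ^ 2 + (2 / v ^ 3 * (2 / v + 2 / v)) / v ^ 3
      + (2 / v) ^ 3 / (v ^ 3 * v) = 20 / v ^ 7"
    using assms by (simp add: field_simps eval_nat_numeral)
  ultimately show ?thesis by linarith
qed

section \<open>Truncations of the formal expansion\<close>

lemma agree_refl: "agree n f f"
  and agree_add: "agree n f g \<Longrightarrow> agree n f' g' \<Longrightarrow> agree n (f + f') (g + g')"
  and agree_diff: "agree n f g \<Longrightarrow> agree n f' g' \<Longrightarrow> agree n (f - f') (g - g')"
  and agree_trans: "agree n f g \<Longrightarrow> agree n g h \<Longrightarrow> agree n f h"
  and agree_mono: "m \<le> n \<Longrightarrow> agree n f g \<Longrightarrow> agree m f g"
  by (auto simp: agree_def)

lemma agree_0_mult: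
  assumes "agree m f 0" "agree n g 0"
  shows "agree (Suc (m + n)) (f * g) 0"
  unfolding agree_def
proof (intro allI impI)
  fix d assume d: "d \<le> Suc (m + n)"
  have "fps_nth f i * fps_nth g (d - i) = 0" if "i \<in> {0..d}" for i
  proof (cases "i \<le> m")
    case True
    then show ?thesis using assms(1) by (simp add: agree_def)
  next
    case False
    with d have "d - i \<le> n" by simp
    then show ?thesis using assms(2) by (simp add: agree_def)
  qed
  then show "fps_nth (f * g) d = fps_nth 0 d"
    unfolding fps_mult_nth fps_zero_nth by (intro sum.neutral ballI)
qed

text \<open>A factor that vanishes up to some degree raises the degree up to which a product is known. This
  is why each step of the recursions below extends a truncation by two degrees.\<close>

lemma agree_mult_gain:
  assumes "agree m f g" "agree n f' g'" "agree a g 0" "agree b f' 0"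
    and "k \<le> Suc (m + b)" "k \<le> Suc (a + n)"
  shows "agree k (f * f') (g * g')"
proof -
  have "agree m (f - g) 0" "agree n (f' - g') 0"
    using assms(1,2) by (simp_all add: agree_def)
  from agree_0_mult[OF this(1) assms(4)] agree_0_mult[OF assms(3) this(2)]
  have "agree k ((f - g) * f') 0" "agree k (g * (f' - g')) 0"
    using assms(5,6) agree_mono by blast+
  from agree_add[OF this] have "agree k (f * f' - g * g') 0"
    by (simp add: algebra_simps)
  then show ?thesis by (simp add: agree_def)
qed

text \<open>Summing the geometric series gives \<open>cinv j = uinv j / (1 + uinv j * cinv (j + 1))\<close>; this is
  that relation without division, in a form that can be iterated.\<close>

lemma cinv_rec: "cinv j = uinv j - uinv j * (cinv (j + 1) * cinv j)"
proof -
  let ?x = "uinv j" and ?C = "cinv (j + 1)"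
  have "agree (Suc n) (cinv j * (1 + ?x * ?C)) ?x" for n
  proof -
    let ?S = "\<Sum>k<Suc n. (-1) ^ k * ?x ^ (k + 1) * ?C ^ k"
    have "agree (Suc n) (cinv j) (cinv_approx (Suc n) j)"
      using agree_cinv[of "Suc n" j] by (simp add: agree_def)
    moreover have "agree (Suc n) (cinv_approx (Suc n) j) ?S"
      unfolding cinv_approx.simps lessThan_Suc_atMost[symmetric]
      by (rule agree_partial[OF agree_cinv le_refl le_refl])
    ultimately have "agree (Suc n) (cinv j * (1 + ?x * ?C)) (?S * (1 + ?x * ?C))"
      by (intro agree_mult agree_refl) (rule agree_trans)
    \<comment> \<open>Telescoping the finite geometric sum leaves \<open>?x\<close> and a term of order \<open>n + 2\<close>.\<close>
    moreover have "?S * (1 + ?x * ?C) = ?x - ?x ^ Suc (Suc n) * (-1) ^ Suc n * ?C ^ Suc n"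
    proof -
      have "?S = ?x * (\<Sum>k<Suc n. (- (?x * ?C)) ^ k)"
        unfolding sum_distrib_left power_minus[of "?x * ?C"] power_mult_distrib
        by (intro sum.cong) (simp_all add: ac_simps)
      moreover have "(\<Sum>k<Suc n. (- (?x * ?C)) ^ k) * (1 + ?x * ?C) = 1 - (- (?x * ?C)) ^ Suc n"
        using one_diff_power_eq[of "- (?x * ?C)" "Suc n"] by (simp only: mult.commute diff_minus_eq_add)
      ultimately have "?S * (1 + ?x * ?C) = ?x * (1 - (- (?x * ?C)) ^ Suc n)"
        by (simp only: mult.assoc)
      also have "\<dots> = ?x - ?x ^ Suc (Suc n) * (-1) ^ Suc n * ?C ^ Suc n"
        unfolding power_minus[of "?x * ?C"] power_mult_distrib
        by (simp add: algebra_simps)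
      finally show ?thesis .
    qed
    moreover have "agree (Suc n) (?x - ?x ^ Suc (Suc n) * (-1) ^ Suc n * ?C ^ Suc n) (?x - 0)"
      unfolding mult.assoc by (intro agree_diff agree_refl agree_uinv_power)
    ultimately show ?thesis using agree_trans by (simp only: diff_zero)
  qed
  then have "cinv j * (1 + ?x * ?C) = ?x"
    unfolding agree_def by (intro fps_ext) (use le_SucI le_refl in blast)
  then show ?thesis by (simp add: algebra_simps)
qed

lemma uinv_no_const: "agree 0 (uinv j) 0"
  by (simp add: agree_def uinv_nth_0)

lemma no_const_mult: "agree 0 f 0 \<Longrightarrow> agree 0 (f * g) 0"
  and no_const_diff: "agree 0 f 0 \<Longrightarrow> agree 0 g 0 \<Longrightarrow> agree 0 (f - g) 0"
  by (auto simp: agree_def)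

lemma cinv_no_const: "agree 0 (cinv j) 0"
  by (subst cinv_rec) (intro no_const_diff no_const_mult uinv_no_const)

lemma agree_cinv_step:
  assumes "agree n (cinv (j + 1)) f" "agree n (cinv j) g" "agree 0 f 0"
  shows "agree (Suc (Suc n)) (cinv j) (uinv j - uinv j * (f * g))"
  by (subst cinv_rec)
     (rule agree_diff[OF agree_refl agree_uinv_mult
        [OF agree_mult_gain[OF assms cinv_no_const]]], simp_all)

lemma cinv_degree_2: "agree 2 (cinv j) (uinv j)"
  using agree_cinv_step[of 0 j 0 0] cinv_no_const[of j] cinv_no_const[of "j + 1"]
  by (simp add: agree_refl numeral_2_eq_2)

lemma cinv_degree_4: "agree 4 (cinv j) (uinv j - uinv j * (uinv (j + 1) * uinv j))"
  using agree_cinv_step[OF cinv_degree_2 cinv_degree_2 uinv_no_const]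
  by (simp add: numeral_eq_Suc)

lemma cinv_degree_6:
  "agree 6 (cinv j) (uinv j - uinv j *
     ((uinv (j + 1) - uinv (j + 1) * (uinv (j + 2) * uinv (j + 1))) *
      (uinv j - uinv j * (uinv (j + 1) * uinv j))))"
  using agree_cinv_step[OF cinv_degree_4 cinv_degree_4, of j]
  by (simp add: numeral_eq_Suc uinv_no_const no_const_mult no_const_diff)

lemma norm_expansion_no_const: "agree 0 (norm_expansion i) 0"
  by (induction i)
     (auto simp: power2_eq_square agree_def cinv_no_const[unfolded agree_def, simplified])

text \<open>One factor \<open>cinv (i + 2)\<close> gains one degree over \<open>n\<close>, the other a second one, so that \<open>g\<close>
  need only be accurate to degree \<open>n\<close>; the bare summand \<open>cinv (i + 2)\<close> has to be known to degree
  \<open>n + 2\<close>.\<close>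

lemma agree_norm_expansion_step:
  assumes "agree n (norm_expansion i) f" "agree n (cinv (i + 2)) g"
    and "agree (Suc (Suc n)) (cinv (i + 2)) h" "agree 0 f 0" "agree 0 g 0"
  shows "agree (Suc (Suc n)) (norm_expansion (Suc i)) (h - f * g * g)"
proof -
  have "agree (Suc n) (norm_expansion i * cinv (i + 2)) (f * g)"
    by (rule agree_mult_gain[OF assms(1,2,4) cinv_no_const]) simp_all
  moreover have "agree 1 (f * g) 0"
    using agree_0_mult[OF assms(4,5)] by simp
  ultimately have "agree (Suc (Suc n)) (norm_expansion i * cinv (i + 2) * cinv (i + 2)) (f * g * g)"
    by (rule agree_mult_gain[OF _ assms(2) _ cinv_no_const]) simp_all
  from agree_diff[OF assms(3) this] show ?thesis
    by (simp add: power2_eq_square mult.assoc)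
qed

text \<open>For index 0 the exceptional term with \<open>half\<close> has degree 3, so it does not disturb the leading
  term.\<close>

lemma norm_expansion_degree_2: "agree 2 (norm_expansion i) (uinv (i + 1))"
proof (cases i)
  case 0
  have "agree 2 (half * cinv 0 * cinv 1 ^ 2) 0"
    using agree_0_mult[OF agree_0_mult[OF no_const_mult[OF cinv_no_const] cinv_no_const] cinv_no_const,
        of 0 half 1 1]
    by (simp add: power2_eq_square ac_simps numeral_2_eq_2)
  from agree_diff[OF cinv_degree_2[of 1] this] show ?thesis by (simp add: 0)
next
  case (Suc k)
  show ?thesis
    using agree_norm_expansion_step[of 0 k 0 0 "uinv (k + 2)"]
      norm_expansion_no_const[of k] cinv_no_const[of "k + 2"] cinv_degree_2[of "k + 2"]
    by (simp add: Suc agree_refl numeral_2_eq_2)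
qed

text \<open>Two steps of the recursion lead from degree 2 to degree 6. The series contains only monomials of
  odd degree up to this point, so nothing new appears in degree 6.\<close>

lemma norm_expansion_degree_6:
  "agree 6 (norm_expansion (i + 2))
     (uinv (i+3) * (1 - uinv (i+2) * uinv (i+3) - uinv (i+3) * uinv (i+4)
        + (uinv (i+2) * uinv (i+3) + uinv (i+3) * uinv (i+4)) ^ 2
        + uinv (i+1) * uinv (i+2) ^ 2 * uinv (i+3)
        + uinv (i+3) * uinv (i+4) ^ 2 * uinv (i+5)))"
  (is "agree 6 _ ?T")
proof -
  define q p a b c where "q = uinv (i+1)" and "p = uinv (i+2)" and "a = uinv (i+3)"
    and "b = uinv (i+4)" and "c = uinv (i+5)"
  note x_defs = q_def p_def a_def b_def c_def
  have v: "agree 0 q 0" "agree 0 p 0" "agree 0 a 0" "agree 0 b 0"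
    by (simp_all add: x_defs uinv_no_const)
  have "agree 4 (norm_expansion (Suc i)) (p - p * (a * p) - q * p * p)"
    using agree_norm_expansion_step[OF norm_expansion_degree_2 cinv_degree_2, of i]
      cinv_degree_4[of "i + 2"] uinv_no_const
    by (simp add: x_defs numeral_eq_Suc)
  moreover have "agree 4 (cinv (Suc i + 2)) (a - a * (b * a))"
    using cinv_degree_4[of "i + 3"] by (simp add: x_defs numeral_eq_Suc)
  moreover have "agree 6 (cinv (Suc i + 2)) (a - a * ((b - b * (c * b)) * (a - a * (b * a))))"
    using cinv_degree_6[of "i + 3"] by (simp add: x_defs numeral_eq_Suc)
  ultimately have "agree 6 (norm_expansion (i + 2))
      (a - a * ((b - b * (c * b)) * (a - a * (b * a)))
        - (p - p * (a * p) - q * p * p) * (a - a * (b * a)) * (a - a * (b * a)))"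
    (is "agree 6 _ ?P")
    using agree_norm_expansion_step[of 4 "Suc i"] v
    by (simp add: numeral_eq_Suc no_const_diff no_const_mult)
  \<comment> \<open>\<open>?R\<close> collects the monomials of the truncated product that have degree 7 or more, arranged so
    that its vanishing up to degree 6 can be read off factor by factor.\<close>
  moreover define e where "e = a * a * b + a * b * q - 2 * a - 2 * q"
  let ?R = "a * (a * (a * (b * (p * (p * e - a * b) - b * (b * c)))))"
  have R: "agree 6 ?R 0"
  proof -
    have gain: "agree (Suc n) (uinv j * f) 0" if "agree n f 0" for n j f
      using agree_uinv_mult[OF that, of j] by simp
    have diff: "agree n (f - g) 0" if "agree n f 0" "agree n g 0" for n f and g :: uinv_series
      using agree_diff[OF that] by simp
    have "agree 0 e 0" using v by (simp add: agree_def e_def)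
    then have "agree (Suc (Suc (Suc (Suc (Suc (Suc 0)))))) ?R 0"
      unfolding x_defs by (intro gain diff uinv_no_const)
    then show ?thesis by (simp add: numeral_eq_Suc)
  qed
  have "?P = ?T + ?R"
    unfolding x_defs[symmetric] e_def by (simp add: algebra_simps power2_eq_square)
  ultimately show ?thesis
    using R
    by (simp add: agree_def)
qed

section \<open>Expansions of degrees 1, 3 and 5\<close>

theorem theorem8:
  fixes D s :: nat and u :: "nat \<Rightarrow> nat"
  assumes "D > 0" and "squarefree D" and "D mod 4 = 2 \<or> D mod 4 = 3"
    and "is_cf_of u (sqrt (real D))" and "sqrt_period u s"
  shows
    "(\<forall>i. \<exists>\<epsilon>::real. 0 < \<epsilon> \<and> \<epsilon> \<le> 1 \<and>
        real_of_int (conv_norm D u i) / (2 * sqrt (real D)) =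
          1 / real (u (i+1)) - 1 / real (u (i+1)) ^ 2 * (1 / real (u i) + 1 / real (u (i+2))) * \<epsilon>)
   \<and> (\<forall>i\<ge>1. \<forall>v::nat. v > 0 \<and> u (i-1) \<ge> v \<and> u i \<ge> v \<and> u (i+1) \<ge> v \<and> u (i+2) \<ge> v \<and> u (i+3) \<ge> v \<longrightarrow>
        (\<exists>\<epsilon>::real. -1 \<le> \<epsilon> \<and> \<epsilon> \<le> 1 \<and>
          real_of_int (conv_norm D u i) / (2 * sqrt (real D)) =
            1 / real (u (i+1)) *
              (1 - 1 / (real (u i) * real (u (i+1))) - 1 / (real (u (i+1)) * real (u (i+2))))
            + 10 / real v ^ 5 * \<epsilon>))
   \<and> (\<forall>i\<ge>2.
        (\<forall>n\<le>5. fps_nth (norm_expansion i) n = fps_nth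
          (uinv (i+1) *
            (1 - uinv i * uinv (i+1) - uinv (i+1) * uinv (i+2)
               + (uinv i * uinv (i+1) + uinv (i+1) * uinv (i+2)) ^ 2
               + uinv (i-1) * uinv i ^ 2 * uinv (i+1)
               + uinv (i+1) * uinv (i+2) ^ 2 * uinv (i+3))) n)
      \<and> (\<forall>v::nat. v > 0 \<and> (\<forall>j. u j \<ge> v) \<longrightarrow>
          \<bar>real_of_int (conv_norm D u i) / (2 * sqrt (real D)) -
            1 / real (u (i+1)) *
              (1 - 1 / (real (u i) * real (u (i+1))) - 1 / (real (u (i+1)) * real (u (i+2)))
                 + (1 / (real (u i) * real (u (i+1))) + 1 / (real (u (i+1)) * real (u (i+2)))) ^ 2
                 + 1 / (real (u (i-1)) * real (u i) ^ 2 * real (u (i+1)))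
                 + 1 / (real (u (i+1)) * real (u (i+2)) ^ 2 * real (u (i+3))))\<bar>
          < 65 / real v ^ 7))"
proof (intro conjI allI impI)
  let ?x = "sqrt (real D)"
  let ?N = "\<lambda>i. real_of_int (conv_norm D u i) / (2 * ?x)"
  let ?c = "complete_quot u ?x" and ?d = "mirror_quot u ?x"
  note cf = \<open>is_cf_of u ?x\<close>
  have upos: "\<And>j. u j > 0" using cf by (auto simp: is_cf_of_def)
  have xpos: "?x > 0" using \<open>D > 0\<close> by simp
  note N = conv_norm_reciprocal[OF \<open>D > 0\<close> cf]
  note c_gt = complete_quot_gt[OF cf] and c_unfold = complete_quot_unfold[OF cf]
  note d_gt = mirror_quot_gt[of ?x u, OF xpos upos]
  {
    fix i
    define U y y0 where "U = real (u (i+1))" and "y = 1 / ?d i + 1 / ?c (i+2)"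
      and "y0 = 1 / real (u i) + 1 / real (u (i+2))"
    have U: "U > 0" using upos by (simp add: U_def)
    have less: "1 / ?d i < 1 / real (u i)" "1 / ?c (i+2) < 1 / real (u (i+2))"
      using d_gt[of i] c_gt[of "i+2"] upos by (auto intro!: divide_strict_left_mono mult_pos_pos
        simp del: complete_quot.simps dest: le_less_trans[OF of_nat_0_le_iff])
    have "?d i > 0" "?c (i+2) > 0"
      using d_gt[of i] c_gt[of "i+2"] by (meson le_less_trans of_nat_0_le_iff)+
    then have y: "y > 0" by (simp add: y_def add_pos_pos del: complete_quot.simps)
    have y0: "y < y0" using less by (simp add: y_def y0_def del: complete_quot.simps mirror_quot.simps)
    \<comment> \<open>The exact error is \<open>y / (U (U + y))\<close>; this is its quotient by the claimed main part \<open>y0 / U\<^sup>2\<close>.\<close>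
    let ?e = "y / y0 * (U / (U + y))"
    have "0 < ?e" using y y0 U by simp
    moreover have "?e \<le> 1 * 1" using y y0 U by (intro mult_mono) auto
    moreover have "?N i = 1 / U - 1 / U ^ 2 * y0 * ?e"
      unfolding N U_def[symmetric] y_def[symmetric]
      using y y0 U recip_diff[of U y] by (simp add: power2_eq_square)
    ultimately show "\<exists>\<epsilon>. 0 < \<epsilon> \<and> \<epsilon> \<le> 1 \<and> ?N i = 1 / real (u (i+1)) - 1 / real (u (i+1)) ^ 2
        * (1 / real (u i) + 1 / real (u (i+2))) * \<epsilon>"
      unfolding U_def y0_def by (intro exI[of _ ?e]) (simp add: U_def y0_def)
  next
    fix i v :: nat
    assume i: "1 \<le> i"
      and v: "v > 0 \<and> u (i-1) \<ge> v \<and> u i \<ge> v \<and> u (i+1) \<ge> v \<and> u (i+2) \<ge> v \<and> u (i+3) \<ge> v"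
    obtain k where k: "i = Suc k" using i by (cases i) auto
    define V U y y0 where "V = real v" and "U = real (u (i+1))"
      and "y = 1 / ?d i + 1 / ?c (i+2)" and "y0 = 1 / real (u i) + 1 / real (u (i+2))"
    have V: "V > 0" "V \<le> U" "V \<le> real (u i)" "V \<le> real (u (i+2))" "V \<le> real (u k)"
      "V \<le> real (u (i+3))" using v by (simp_all add: V_def U_def k)
    have d: "?d i = real (u i) + 1 / ?d k" by (simp add: k)
    have c: "?c (i+2) = real (u (i+2)) + 1 / ?c (i+3)"
      using c_unfold[of "i+2"] by (simp add: eval_nat_numeral del: complete_quot.simps)
    \<comment> \<open>This includes \<open>k = 0\<close>: the mirrored quotient then is \<open>u 0 + \<surd>D\<close>, which also exceeds \<open>u 0\<close>.\<close>
    have tail: "?d k \<ge> V" "?c (i+3) \<ge> V"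
      using d_gt[of k] c_gt[of "i+3"] V by linarith+
    note b1 = recip_shift_bounds[of V "real (u i)" "1 / ?d k", folded d]
    note b2 = recip_shift_bounds[of V "real (u (i+2))" "1 / ?c (i+3)", folded c]
    have le: "1 / ?d k \<le> 1 / V" "1 / ?c (i+3) \<le> 1 / V" "0 \<le> 1 / ?d k" "0 \<le> 1 / ?c (i+3)"
      using tail V(1) by (auto intro!: divide_left_mono simp del: complete_quot.simps)
    have dy: "\<bar>y - y0\<bar> \<le> 2 / V ^ 3"
      using b1 b2 V le by (simp add: y_def y0_def del: complete_quot.simps mirror_quot.simps)
    have "1 / ?d i \<le> 1 / V" "1 / ?c (i+2) \<le> 1 / V" "0 \<le> 1 / ?d i" "0 \<le> 1 / ?c (i+2)"
      using V d_gt[of i] c_gt[of "i+2"]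
      by (auto intro!: divide_left_mono simp del: complete_quot.simps)
    then have y: "0 \<le> y" "y \<le> 2 / V" by (simp_all add: y_def)
    let ?E = "?N i - (1 / U - y0 / U ^ 2)"
    have "\<bar>?E\<bar> \<le> 6 / V ^ 5"
      unfolding N U_def[symmetric] y_def[symmetric]
      by (rule recip_error_degree_3[OF V(1,2) y dy])
    also have "\<dots> \<le> 10 / V ^ 5" using V by (simp add: divide_right_mono)
    finally have bound: "\<bar>?E\<bar> \<le> 10 / V ^ 5" .
    have "\<bar>e * V ^ 5 / 10\<bar> \<le> 1" if "\<bar>e\<bar> \<le> 10 / V ^ 5" for e
      using that V(1) by (simp add: abs_mult pos_le_divide_eq)
    from this[OF bound] have e: "\<bar>?E * V ^ 5 / 10\<bar> \<le> 1" .
    have main: "1 / U * (1 - 1 / (real (u i) * U) - 1 / (U * real (u (i+2)))) = 1 / U - y0 / U ^ 2"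
      using V by (simp add: y0_def field_simps power2_eq_square)
    define \<epsilon> where "\<epsilon> = ?E * V ^ 5 / 10"
    have "?E = 10 / V ^ 5 * \<epsilon>" using V by (simp add: \<epsilon>_def)
    then have "?N i = 1 / U * (1 - 1 / (real (u i) * U) - 1 / (U * real (u (i+2)))) + 10 / V ^ 5 * \<epsilon>"
      unfolding main by linarith
    moreover have "-1 \<le> \<epsilon>" "\<epsilon> \<le> 1" using e unfolding \<epsilon>_def[symmetric] by linarith+
    ultimately show "\<exists>\<epsilon>. -1 \<le> \<epsilon> \<and> \<epsilon> \<le> 1 \<and> ?N i = 1 / real (u (i+1)) *
        (1 - 1 / (real (u i) * real (u (i+1))) - 1 / (real (u (i+1)) * real (u (i+2))))
        + 10 / real v ^ 5 * \<epsilon>"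
      unfolding U_def V_def by blast
  next
    fix i n :: nat
    assume i: "2 \<le> i" and n: "n \<le> 5"
    obtain k where "i = k + 2" using i by (metis add.commute le_Suc_ex)
    then show "fps_nth (norm_expansion i) n = fps_nth
          (uinv (i+1) *
            (1 - uinv i * uinv (i+1) - uinv (i+1) * uinv (i+2)
               + (uinv i * uinv (i+1) + uinv (i+1) * uinv (i+2)) ^ 2
               + uinv (i-1) * uinv i ^ 2 * uinv (i+1)
               + uinv (i+1) * uinv (i+2) ^ 2 * uinv (i+3))) n"
      using norm_expansion_degree_6[of k] n
      by (simp add: agree_def numeral_eq_Suc)
  next
    fix i v :: nat
    assume i: "2 \<le> i" and v: "v > 0 \<and> (\<forall>j. u j \<ge> v)"
    obtain k where k: "i = Suc (Suc k)" using i by (metis add_2_eq_Suc le_Suc_ex)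
    define V where "V = real v"
    define U a b a' b' where "U = real (u (i+1))" and "a = real (u i)" and "b = real (u (i-1))"
      and "a' = real (u (i+2))" and "b' = real (u (i+3))"
    define y y0 y1 where "y = 1 / ?d i + 1 / ?c (i+2)" and "y0 = 1 / a + 1 / a'"
      and "y1 = (1 / a - 1 / (a ^ 2 * b)) + (1 / a' - 1 / (a' ^ 2 * b'))"
    have Vu: "V > 0" "\<And>j. V \<le> real (u j)" using v by (simp_all add: V_def)
    then have V: "V \<le> U" "V \<le> a" "V \<le> b" "V \<le> a'" "V \<le> b'"
      by (simp_all add: U_def a_def b_def a'_def b'_def)
    have d: "?d i = a + 1 / ?d (Suc k)" "?d (Suc k) = b + 1 / ?d k"
      by (simp_all add: k a_def b_def)
    have c: "?c (i+2) = a' + 1 / ?c (i+3)" "?c (i+3) = b' + 1 / ?c (i+4)"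
      using c_unfold[of "i+2"] c_unfold[of "i+3"]
      by (simp_all add: eval_nat_numeral a'_def b'_def del: complete_quot.simps)
    have cV: "?c j \<ge> V" and dV: "?d j \<ge> V" for j
      using c_gt[of j] d_gt[of j] Vu(2)[of j] by linarith+
    have cr: "0 \<le> 1 / ?c j" "1 / ?c j \<le> 1 / V" and dr: "0 \<le> 1 / ?d j" "1 / ?d j \<le> 1 / V" for j
      using cV[of j] dV[of j] Vu(1) by (auto intro!: divide_left_mono simp del: complete_quot.simps)
    have y: "0 \<le> y" "y \<le> 2 / V"
      using cr[of "i+2"] dr[of i] by (simp_all add: y_def)
    have "1 / a \<le> 1 / V" "1 / a' \<le> 1 / V" "0 \<le> 1 / a" "0 \<le> 1 / a'"
      using V Vu(1) by (auto intro!: divide_left_mono)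
    then have y0: "0 \<le> y0" "y0 \<le> 2 / V" by (simp_all add: y0_def)
    have dy0: "\<bar>y - y0\<bar> \<le> 2 / V ^ 3"
      using recip_shift_bounds[OF Vu(1) V(2) dr[of "Suc k"], folded d]
        recip_shift_bounds[OF Vu(1) V(4) cr[of "i+3"], folded c]
      by (simp add: y_def y0_def del: complete_quot.simps mirror_quot.simps)
    have "\<bar>y - y1\<bar> \<le> 2 / V ^ 5 + 2 / V ^ 5"
      unfolding y_def y1_def
      by (rule order_trans[OF abs_diff_triangle_ineq add_mono
            [OF recip_two_levels_bound[OF Vu(1) V(2,3) dr[of k], folded d]
              recip_two_levels_bound[OF Vu(1) V(4,5) cr[of "i+4"], folded c]]])
    then have dy1: "\<bar>y - y1\<bar> \<le> 4 / V ^ 5" by simp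
    have main: "1 / U * (1 - 1 / (a * U) - 1 / (U * a') + (1 / (a * U) + 1 / (U * a')) ^ 2
            + 1 / (b * a ^ 2 * U) + 1 / (U * a' ^ 2 * b')) = 1 / U - y1 / U ^ 2 + y0 ^ 2 / U ^ 3"
    proof -
      have nz: "U \<noteq> 0" "a \<noteq> 0" "b \<noteq> 0" "a' \<noteq> 0" "b' \<noteq> 0" using V Vu(1) by auto
      then have "1 / (a * U) + 1 / (U * a') = y0 / U"
        by (simp add: y0_def field_simps)
      moreover have "1 - 1 / (a * U) - 1 / (U * a') + 1 / (b * a ^ 2 * U) + 1 / (U * a' ^ 2 * b')
          = 1 - y1 / U"
        using nz by (simp add: y1_def add_divide_distrib diff_divide_distrib ac_simps)
      ultimately have "1 - 1 / (a * U) - 1 / (U * a') + (1 / (a * U) + 1 / (U * a')) ^ 2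
            + 1 / (b * a ^ 2 * U) + 1 / (U * a' ^ 2 * b') = 1 - y1 / U + (y0 / U) ^ 2"
        by simp
      moreover have "1 / U * (1 - y1 / U + (y0 / U) ^ 2) = 1 / U - y1 / U ^ 2 + y0 ^ 2 / U ^ 3"
        by (simp add: distrib_left right_diff_distrib power_divide eval_nat_numeral)
      ultimately show ?thesis by (simp only:)
    qed
    have "\<bar>?N i - (1 / U - y1 / U ^ 2 + y0 ^ 2 / U ^ 3)\<bar> \<le> 20 / V ^ 7"
      unfolding N U_def[symmetric] y_def[symmetric]
      by (rule recip_error_degree_5[OF Vu(1) V(1) y y0 dy0 dy1])
    also have "20 / V ^ 7 < 65 / V ^ 7" using Vu(1) by (simp add: divide_strict_right_mono)
    finally show "\<bar>?N i - 1 / real (u (i+1)) *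
              (1 - 1 / (real (u i) * real (u (i+1))) - 1 / (real (u (i+1)) * real (u (i+2)))
                 + (1 / (real (u i) * real (u (i+1))) + 1 / (real (u (i+1)) * real (u (i+2)))) ^ 2
                 + 1 / (real (u (i-1)) * real (u i) ^ 2 * real (u (i+1)))
                 + 1 / (real (u (i+1)) * real (u (i+2)) ^ 2 * real (u (i+3))))\<bar>
          < 65 / real v ^ 7"
      unfolding U_def[symmetric] a_def[symmetric] b_def[symmetric] a'_def[symmetric]
        b'_def[symmetric] V_def[symmetric] main .
  }
qed

end
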